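(* Let $d\ge 3$ and $0\le m\le d$. Let $\mathcal{U}_m$ be the graph with vertex set $\mathbb{N}_0^m\times\mathbb{Z}^{d-m}$ and nearest-neighbour edges with unit conductances, and let $G_m$ be the Green's function of the random walk on $\mathcal{U}_m$. Let $g$ be the Green's function of the simple random walk on $\mathbb{Z}^d$. Then for all $x,y\in\mathbb{N}_0^m\times\mathbb{Z}^{d-m}$, \[ G_{m}(x,y)=\sum_{v\in\{0,1\}^{m}\times\{0\}^{d-m}}g\left(x,\left((-1)^{v_i}\left(y_i+\tfrac12\right)-\tfrac12\right)_{i=1}^{d}\right). \] In particular, writing $\mathcal{O}=\mathcal{U}_d$ for the orthant (vertex set $\mathbb{N}_0^d$) and $G_{\mathcal{O}}=G_d$, for all $x,y\in\mathbb{N}_0^d$, \[ G_{\mathcal{O}}(x,y)=\sum_{v\in\{0,1\}^{d}}g\left(x,\left((-1)^{v_i}\left(y_i+\tfrac12\right)-\tfrac12\right)_{i=1}^{d}\right). \]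
   Context: $\mathbb{N}_0=\{0,1,2,\ldots\}$. Let $\mathcal{G}=(V,E)$ be a connected graph of bounded degree in which each edge $\{x,y\}\in E$ carries a positive finite conductance $c_{\mathcal{G}}(x,y)$; write $x\sim y$ if $\{x,y\}\in E$, and $\pi_{\mathcal{G}}(x):=\sum_{y\sim x}c_{\mathcal{G}}(x,y)$. The random walk $(S_n)_{n\ge 0}$ on $\mathcal{G}$ is the discrete-time Markov chain with transition probabilities $\mathsf{P}(S_{n+1}=y\mid S_n=x)=c_{\mathcal{G}}(x,y)/\pi_{\mathcal{G}}(x)$ for $y\sim x$. When this walk is transient its (normalized) Green's function is \[ G_{\mathcal{G}}(x,y)=\frac{1}{\pi_{\mathcal{G}}(y)}\,\mathsf{E}_x\Big[\sum_{n\ge 0}\mathbf{1}_{\{S_n=y\}}\Big],\qquad x,y\in V, \] where $\mathsf{E}_x$ is the expectation for the walk started at $x$. There is no killing on the boundary of the graph. With unit conductances $\pi_{\mathcal{G}}(x)=\deg(x)$. Nearest-neighbour edges are the pairs $\{x,y\}$ of vertices with $\|x-y\|=1$ ($\|\cdot\|$ Euclidean norm). $g(x,y)$ denotes the Green's function in this sense of $\mathbb{Z}^d$ with nearest-neighbour edges and unit conductances; thus $g(x,y)=\frac{1}{2d}\mathsf{E}_x[\sum_{n\ge 0}\mathbf{1}_{\{S_n=y\}}]$ for the simple random walk $S$ on $\mathbb{Z}^d$. *)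

theory Defs
  imports "HOL-Probability.Probability"
begin

section \<open>Random walks on weighted graphs\<close>

text \<open>
  A graph is given by its set \<open>E\<close> of edges, each edge being a two-element set of vertices, and the
  conductances are a function on edges. The vertex set is left implicit: the graphs in question
  have no isolated vertices.
\<close>

definition total_conductance :: "'a set set \<Rightarrow> ('a set \<Rightarrow> real) \<Rightarrow> 'a \<Rightarrow> real" where
  "total_conductance E c x = (\<Sum>y | {x, y} \<in> E. c {x, y})"

text \<open>
  \<open>embed_pmf\<close> is only meaningful if its argument is a probability mass function; lemma
  \<open>pmf_rw_step\<close> shows that this is so at every vertex of finite positive degree. At other points
  of the type, which the walk never visits, the value is irrelevant.
\<close>

definition rw_step :: "'a set set \<Rightarrow> ('a set \<Rightarrow> real) \<Rightarrow> 'a \<Rightarrow> 'a pmf" where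
  "rw_step E c x =
     embed_pmf (\<lambda>y. if {x, y} \<in> E then c {x, y} / total_conductance E c x else 0)"

lemma pmf_rw_step:
  assumes fin: "finite {y. {x, y} \<in> E}" and ne: "{y. {x, y} \<in> E} \<noteq> {}"
    and pos: "\<And>y. {x, y} \<in> E \<Longrightarrow> 0 < c {x, y}"
  shows "pmf (rw_step E c x) y =
           (if {x, y} \<in> E then c {x, y} / total_conductance E c x else 0)"
proof -
  let ?N = "{y. {x, y} \<in> E}" and ?t = "total_conductance E c x"
  let ?f = "\<lambda>y. if {x, y} \<in> E then c {x, y} / ?t else 0"
  have t: "0 < ?t"
    unfolding total_conductance_def using fin ne pos by (intro sum_pos) auto
  have nonneg: "0 \<le> ?f y" for y
    using t pos[of y] by auto
  have "(\<integral>\<^sup>+y. ennreal (?f y) \<partial>count_space UNIV) = (\<Sum>y\<in>?N. ennreal (?f y))"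
    using fin by (intro nn_integral_count_space') auto
  also have "\<dots> = ennreal (\<Sum>y\<in>?N. ?f y)"
    by (rule sum_ennreal) (rule nonneg)
  also have "(\<Sum>y\<in>?N. ?f y) = (\<Sum>y\<in>?N. c {x, y}) / ?t"
    by (simp add: sum_divide_distrib)
  also have "\<dots> = 1"
    using t by (simp add: total_conductance_def)
  finally show ?thesis
    unfolding rw_step_def using nonneg by (intro pmf_embed_pmf) auto
qed

text \<open>
  The law of the walk started at \<open>x\<close> is the measure on trajectories \<open>nat \<Rightarrow> 'a\<close> obtained from the
  one-step kernels by the Ionescu-Tulcea theorem: coordinate \<open>0\<close> is \<open>x\<close>, and coordinate \<open>Suc n\<close>
  given the previous ones is distributed as \<open>rw_step\<close> from coordinate \<open>n\<close>.
\<close>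

definition rw_kernel ::
  "'a set set \<Rightarrow> ('a set \<Rightarrow> real) \<Rightarrow> 'a \<Rightarrow> nat \<Rightarrow> (nat \<Rightarrow> 'a) \<Rightarrow> 'a measure" where
  "rw_kernel E c x n \<omega> =
     measure_pmf (case n of 0 \<Rightarrow> return_pmf x | Suc k \<Rightarrow> rw_step E c (\<omega> k))"

global_interpretation RW: Ionescu_Tulcea "rw_kernel E c x" "\<lambda>_. count_space UNIV"
  for E :: "'a set set" and c x
proof (rule Ionescu_Tulcea.intro)
  fix n :: nat
  show "rw_kernel E c x n \<in> PiM {0..<n} (\<lambda>_. count_space UNIV) \<rightarrow>\<^sub>M subprob_algebra (count_space UNIV)"
  proof (cases n)
    case 0
    then show ?thesis
      by (auto simp: rw_kernel_def[abs_def] space_subprob_algebra intro!: measurable_const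
               measure_pmf.subprob_space_axioms)
  next
    case (Suc k)
    have "(\<lambda>\<omega>. \<omega> k) \<in> PiM {0..<n} (\<lambda>_. count_space UNIV) \<rightarrow>\<^sub>M (count_space UNIV :: 'a measure)"
      using Suc by (intro measurable_component_singleton) auto
    moreover have "(\<lambda>z. measure_pmf (rw_step E c z)) \<in>
        count_space UNIV \<rightarrow>\<^sub>M subprob_algebra (count_space UNIV)"
      by (auto simp: space_subprob_algebra intro!: measure_pmf.subprob_space_axioms)
    ultimately show ?thesis
      unfolding rw_kernel_def[abs_def] Suc by simp
  qed
next
  show "prob_space (rw_kernel E c x n \<omega>)" for n \<omega>
    unfolding rw_kernel_def by (rule measure_pmf.prob_space_axioms)
qed

definition rw_law :: "'a set set \<Rightarrow> ('a set \<Rightarrow> real) \<Rightarrow> 'a \<Rightarrow> (nat \<Rightarrow> 'a) measure" where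
  "rw_law E c x = RW.PF.lim E c x"


lemma emeasure_rw_law_cylinder:
  "emeasure (rw_law E c x) {\<omega>. \<forall>i\<le>n. \<omega> i = p i} =
     (if p 0 = x then \<Prod>i<n. ennreal (pmf (rw_step E c (p i)) (p (Suc i))) else 0)"
proof -
  let ?M = "\<lambda>_::nat. count_space (UNIV :: 'a set)" and ?u = "\<lambda>_::nat. undefined :: 'a"
  define cyl where "cyl k = (\<Pi>\<^sub>E i\<in>{0..<k}. {p i})" for k :: nat
  define w where "w k = (case k of 0 \<Rightarrow> indicator {x} (p 0)
    | Suc i \<Rightarrow> ennreal (pmf (rw_step E c (p i)) (p (Suc i))))" for k
  have sets_cyl [measurable]: "cyl k \<in> sets (PiM {0..<k} ?M)" for k
    unfolding cyl_def by (intro sets_PiM_I_finite) auto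
  have u: "?u \<in> space (PiM {0..<0} ?M)"
    by (simp add: space_PiM)
  have eP: "emeasure (RW.eP E c x k \<omega>) (cyl (Suc k)) = w k * indicator (cyl k) \<omega>"
    if \<omega>: "\<omega> \<in> space (PiM {0..<k} ?M)" for k \<omega>
  proof -
    have ext: "\<omega> \<in> extensional {0..<k}"
      using \<omega> by (auto simp: space_PiM PiE_def)
    have *: "fun_upd \<omega> k -` cyl (Suc k) = (if \<omega> \<in> cyl k then {p k} else {})"
      using ext by (auto simp: cyl_def PiE_iff extensional_def less_Suc_eq split: if_splits)
    have "emeasure (RW.eP E c x k \<omega>) (cyl (Suc k)) =
        emeasure (rw_kernel E c x k \<omega>) (fun_upd \<omega> k -` cyl (Suc k))"
      by (subst RW.emeasure_eP[OF \<omega> sets_cyl]) simp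
    also have "\<dots> = w k * indicator (cyl k) \<omega>"
    proof (cases "\<omega> \<in> cyl k")
      case True
      then have "k = Suc i \<Longrightarrow> \<omega> i = p i" for i
        by (auto simp: cyl_def PiE_iff)
      with True show ?thesis
        by (simp add: * rw_kernel_def w_def emeasure_pmf_single split: nat.split)
           (auto simp: indicator_def)
    qed (simp add: *)
    finally show ?thesis .
  qed
  have C: "emeasure (RW.C E c x 0 k ?u) (cyl k) = (\<Prod>i<k. w i)" for k
  proof (induction k)
    case 0
    show ?case
      using sets_cyl[of 0] by (simp add: cyl_def emeasure_return)
  next
    case (Suc k)
    have "space (RW.C E c x 0 k ?u) \<noteq> {}"
      using RW.prob_space_C[OF u, of E c x k] prob_space.not_empty by blast
    moreover have "RW.eP E c x k \<in> RW.C E c x 0 k ?u \<rightarrow>\<^sub>M subprob_algebra (PiM {0..<Suc k} ?M)"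
      using RW.measurable_eP[of E c x k] RW.sets_C[OF u, of E c x k]
      by (simp cong: measurable_cong_sets)
    ultimately have "emeasure (RW.C E c x 0 (Suc k) ?u) (cyl (Suc k)) =
        (\<integral>\<^sup>+\<omega>. emeasure (RW.eP E c x k \<omega>) (cyl (Suc k)) \<partial>RW.C E c x 0 k ?u)"
      by (simp add: emeasure_bind[OF _ _ sets_cyl])
    also have "\<dots> = (\<integral>\<^sup>+\<omega>. w k * indicator (cyl k) \<omega> \<partial>RW.C E c x 0 k ?u)"
      using RW.space_C[OF u, of E c x k] by (intro nn_integral_cong eP) simp
    also have "\<dots> = w k * emeasure (RW.C E c x 0 k ?u) (cyl k)"
      using RW.sets_C[OF u, of E c x k] by (intro nn_integral_cmult_indicator) simp
    finally show ?case by (simp add: Suc mult.commute)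
  qed
  have "{\<omega>. \<forall>i\<le>n. \<omega> i = p i} = prod_emb UNIV ?M {0..<Suc n} (cyl (Suc n))"
    by (auto simp: prod_emb_def cyl_def PiE_iff space_PiM less_Suc_eq_le)
  then have "emeasure (rw_law E c x) {\<omega>. \<forall>i\<le>n. \<omega> i = p i} =
      emeasure (RW.CI E c x {0..<Suc n}) (cyl (Suc n))"
    unfolding rw_law_def by (simp add: RW.lim[OF _ sets_cyl])
  also have "\<dots> = emeasure (RW.C E c x 0 (Suc n) ?u) (cyl (Suc n))"
    by (subst RW.emeasure_CI[OF order.refl sets_cyl])
       (simp add: prod_emb_id cyl_def PiE_iff)
  also have "\<dots> = (\<Prod>i<Suc n. w i)"
    by (rule C)
  also have "\<dots> = w 0 * (\<Prod>i<n. w (Suc i))"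
    by (rule prod.lessThan_Suc_shift)
  also have "\<dots> = (if p 0 = x then \<Prod>i<n. ennreal (pmf (rw_step E c (p i)) (p (Suc i))) else 0)"
    by (simp add: w_def)
  finally show ?thesis .
qed

text \<open>
  The expected number of visits is taken in \<open>[0, \<infinity>]\<close>, so that no junk value is assigned to a
  recurrent walk; the Green's function is finite exactly when it is defined as a real number.
\<close>

definition green :: "'a set set \<Rightarrow> ('a set \<Rightarrow> real) \<Rightarrow> 'a \<Rightarrow> 'a \<Rightarrow> ennreal" where
  "green E c x y =
     (\<integral>\<^sup>+\<omega>. (\<Sum>n. indicator {y} (\<omega> n)) \<partial>rw_law E c x) / ennreal (total_conductance E c y)"


section \<open>Lattices with nearest-neighbour edges\<close>

text \<open>
  Points of \<open>d\<close>-dimensional Euclidean space are the extensional functions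
  \<open>nat \<Rightarrow> real\<close> on the index set \<open>{1..d}\<close>; the sets \<open>\<nat>\<close> and \<open>\<int>\<close> below are sets of reals.
\<close>

definition nn_edges :: "nat \<Rightarrow> (nat \<Rightarrow> real) set \<Rightarrow> (nat \<Rightarrow> real) set set" where
  "nn_edges d V = {{x, y} | x y. x \<in> V \<and> y \<in> V \<and> L2_set (\<lambda>i. x i - y i) {1..d} = 1}"

definition nn_green :: "nat \<Rightarrow> (nat \<Rightarrow> real) set \<Rightarrow> (nat \<Rightarrow> real) \<Rightarrow> (nat \<Rightarrow> real) \<Rightarrow> ennreal" where
  "nn_green d V = green (nn_edges d V) (\<lambda>_. 1)"

definition zlattice :: "nat \<Rightarrow> (nat \<Rightarrow> real) set" where
  "zlattice d = ({1..d} \<rightarrow>\<^sub>E \<int>)"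

definition orthant :: "nat \<Rightarrow> (nat \<Rightarrow> real) set" where
  "orthant d = ({1..d} \<rightarrow>\<^sub>E \<nat>)"

definition partial_orthant :: "nat \<Rightarrow> nat \<Rightarrow> (nat \<Rightarrow> real) set" where
  "partial_orthant d m = (\<Pi>\<^sub>E i\<in>{1..d}. if i \<le> m then \<nat> else \<int>)"

definition reflect :: "nat \<Rightarrow> (nat \<Rightarrow> nat) \<Rightarrow> (nat \<Rightarrow> real) \<Rightarrow> nat \<Rightarrow> real" where
  "reflect d v y = (\<lambda>i\<in>{1..d}. (-1) ^ v i * (y i + 1 / 2) - 1 / 2)"

lemma reflect_in_zlattice:
  assumes "y \<in> zlattice d"
  shows "reflect d v y \<in> zlattice d"
proof -
  have "(-1) ^ v i * (y i + 1 / 2) - 1 / 2 \<in> \<int>" if "i \<in> {1..d}" for i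
  proof -
    have "y i \<in> \<int>" using assms that by (auto simp: zlattice_def)
    then show ?thesis by (cases "even (v i)") auto
  qed
  then show ?thesis by (auto simp: reflect_def zlattice_def)
qed

lemma finite_nn_neighbours:
  assumes "V \<subseteq> zlattice d"
  shows "finite {y. {x, y} \<in> nn_edges d V}"
proof (rule finite_subset)
  show "{y. {x, y} \<in> nn_edges d V} \<subseteq> (\<Pi>\<^sub>E i\<in>{1..d}. {k \<in> \<int>. \<bar>k\<bar> \<le> \<bar>x i\<bar> + 1})"
  proof
    fix y assume "y \<in> {y. {x, y} \<in> nn_edges d V}"
    then have y: "y \<in> zlattice d" and
      "L2_set (\<lambda>i. x i - y i) {1..d} = 1 \<or> L2_set (\<lambda>i. y i - x i) {1..d} = 1"
      using assms by (auto simp: nn_edges_def doubleton_eq_iff)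
    moreover have "L2_set (\<lambda>i. y i - x i) {1..d} = L2_set (\<lambda>i. x i - y i) {1..d}"
      by (simp add: L2_set_def power2_commute)
    ultimately have 1: "L2_set (\<lambda>i. x i - y i) {1..d} = 1" by auto
    have "\<bar>y i\<bar> \<le> \<bar>x i\<bar> + 1" if "i \<in> {1..d}" for i
    proof -
      have "L2_set (\<lambda>i. \<bar>x i - y i\<bar>) {1..d} = 1" using 1 by (simp add: L2_set_def)
      then have "\<bar>x i - y i\<bar> \<le> 1"
        using member_le_L2_set[of "{1..d}" i "\<lambda>i. \<bar>x i - y i\<bar>"] that by simp
      then show ?thesis by linarith
    qed
    with y show "y \<in> (\<Pi>\<^sub>E i\<in>{1..d}. {k \<in> \<int>. \<bar>k\<bar> \<le> \<bar>x i\<bar> + 1})"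
      by (auto simp: zlattice_def PiE_iff)
  qed
qed (auto intro!: finite_PiE finite_abs_int_segment)

lemma partial_orthant_subset: "partial_orthant d m \<subseteq> zlattice d"
  unfolding partial_orthant_def zlattice_def using Nats_subset_Ints by (intro PiE_mono) auto

lemma partial_orthant_0: "partial_orthant d 0 = zlattice d"
  by (auto simp: partial_orthant_def zlattice_def PiE_iff)

lemma partial_orthant_full: "partial_orthant d d = orthant d"
  by (auto simp: partial_orthant_def orthant_def PiE_iff)

lemma partial_orthant_has_neighbour:
  assumes "x \<in> partial_orthant d m" "1 \<le> d"
  shows "{y. {x, y} \<in> nn_edges d (partial_orthant d m)} \<noteq> {}"
proof -
  let ?y = "x(1 := x 1 + 1)"
  have "?y \<in> partial_orthant d m"
    using assms by (auto simp: partial_orthant_def PiE_iff extensional_def intro: Nats_add Ints_add)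
  moreover have "L2_set (\<lambda>i. x i - ?y i) {1..d} = 1"
  proof -
    have "(\<Sum>i\<in>{1..d}. (x i - ?y i)\<^sup>2) = (\<Sum>i\<in>{1..d}. if i = 1 then 1 else 0)"
      by (intro sum.cong) auto
    then show ?thesis using assms by (simp add: L2_set_def)
  qed
  ultimately show ?thesis
    using assms unfolding nn_edges_def by blast
qed

end

theory Submission
  imports Defs
begin

text \<open>
  The identity is the method of images for reflecting faces. Folding the lattice along the
  hyperplanes where a coordinate \<open>i \<le> m\<close> equals \<open>-1/2\<close> maps it onto the partial orthant, and maps
  simple random walk to a walk on the orthant that holds still whenever it attempts to step outside
  (lemmas \<open>fold_orthant_move\<close> and \<open>fold_orthant_move_stay\<close>). This lazy walk has an additional loop
  at a boundary vertex for each missing neighbour. Loops carry no current, so the Green's function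
  normalized by conductance is the same with and without them, and the visits of the folded walk
  to \<open>y\<close> are the visits of the lattice walk to the points that fold onto \<open>y\<close>, which are the
  points \<open>reflect d v y\<close> (lemma \<open>reflect_fibre\<close>).

  The argument is carried out for functions rather than for trajectories. The Green's function is the
  least nonnegative solution of the discrete Poisson equation with a unit charge at \<open>y\<close> (lemmas
  \<open>green_eq_potential\<close>, \<open>potential_equation\<close> and \<open>potential_least\<close>). The sum over the images, as the
  least solution on the lattice with a charge at every image, is symmetric under the reflections
  (\<open>nn_potential_mirror\<close>) and restricts to a solution on the orthant. The Green's function of the
  orthant, composed with the folding map, is a solution on the lattice. Minimality yields both
  inequalities.

  Solutions take values in \<open>[0, \<infinity>]\<close>, and removing the loop terms requires cancelling a multiple of
  the solution, so finiteness has to be known. It holds in dimension at least three, where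
  \<open>1 / sqrt (5 + r\<^sup>2)\<close>, with \<open>r\<close> the distance from \<open>y\<close> in the first three coordinates, is superharmonic on
  the lattice and strictly so at \<open>y\<close>; by minimality a multiple of it bounds the Green's function
  (lemmas \<open>inverse_sqrt_superharmonic\<close> and \<open>nn_potential_zlattice_finite\<close>).
\<close>


section \<open>Potentials of random walks\<close>

definition step_mean :: "'a set set \<Rightarrow> ('a set \<Rightarrow> real) \<Rightarrow> ('a \<Rightarrow> ennreal) \<Rightarrow> 'a \<Rightarrow> ennreal" where
  "step_mean E c f x = (\<integral>\<^sup>+z. f z \<partial>rw_step E c x)"

text \<open>
  The Ionescu-Tulcea construction builds the trajectory up to time \<open>n\<close> by prolonging the one up to
  time \<open>n - 1\<close>, so integrating out the last coordinate replaces \<open>f\<close> by its one-step mean. In this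
  way expectations over trajectories are traded for iterates of a linear operator.
\<close>

lemma nn_integral_rw_law:
  "(\<integral>\<^sup>+\<omega>. f (\<omega> n) \<partial>rw_law E c x) = (step_mean E c ^^ n) f x"
proof -
  let ?M = "\<lambda>_::nat. count_space (UNIV :: 'a set)" and ?u = "\<lambda>_::nat. undefined :: 'a"
  have u: "?u \<in> space (PiM {0..<0} ?M)"
    by (simp add: space_PiM)
  have meas: "(\<lambda>\<omega>. f (\<omega> k)) \<in> borel_measurable (PiM {0..<Suc k} ?M)" for k and f :: "'a \<Rightarrow> ennreal"
  proof -
    have "(\<lambda>\<omega>. \<omega> k) \<in> PiM {0..<Suc k} ?M \<rightarrow>\<^sub>M (count_space UNIV :: 'a measure)"
      by (intro measurable_component_singleton) auto
    then show ?thesis by (rule measurable_compose) simp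
  qed
  have C: "(\<integral>\<^sup>+\<omega>. f (\<omega> k) \<partial>RW.C E c x 0 (Suc k) ?u) =
      (\<integral>\<^sup>+\<omega>. (\<integral>\<^sup>+z. f z \<partial>rw_kernel E c x k \<omega>) \<partial>RW.C E c x 0 k ?u)"
    for k and f :: "'a \<Rightarrow> ennreal"
  proof -
    have "RW.eP E c x k \<in> RW.C E c x 0 k ?u \<rightarrow>\<^sub>M subprob_algebra (PiM {0..<Suc k} ?M)"
      using RW.measurable_eP[of E c x k] RW.sets_C[OF u, of E c x k]
      by (simp cong: measurable_cong_sets)
    then have "(\<integral>\<^sup>+\<omega>. f (\<omega> k) \<partial>RW.C E c x 0 (Suc k) ?u) =
        (\<integral>\<^sup>+\<omega>. (\<integral>\<^sup>+\<omega>'. f (\<omega>' k) \<partial>RW.eP E c x k \<omega>) \<partial>RW.C E c x 0 k ?u)"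
      by (simp add: nn_integral_bind[OF meas])
    also have "\<dots> = (\<integral>\<^sup>+\<omega>. (\<integral>\<^sup>+z. f z \<partial>rw_kernel E c x k \<omega>) \<partial>RW.C E c x 0 k ?u)"
      using RW.space_C[OF u, of E c x k]
      by (intro nn_integral_cong) (simp add: RW.nn_integral_eP[OF _ meas])
    finally show ?thesis .
  qed
  have law: "(\<integral>\<^sup>+\<omega>. f (\<omega> k) \<partial>RW.C E c x 0 (Suc k) ?u) = (step_mean E c ^^ k) f x"
    for k and f :: "'a \<Rightarrow> ennreal"
  proof (induction k arbitrary: f)
    case 0
    show ?case
      by (subst C) (simp add: rw_kernel_def nn_integral_return)
  next
    case (Suc k)
    have "(\<integral>\<^sup>+\<omega>. f (\<omega> (Suc k)) \<partial>RW.C E c x 0 (Suc (Suc k)) ?u) =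
        (\<integral>\<^sup>+\<omega>. step_mean E c f (\<omega> k) \<partial>RW.C E c x 0 (Suc k) ?u)"
      by (subst C) (simp add: rw_kernel_def step_mean_def del: RW.C.simps)
    also have "\<dots> = (step_mean E c ^^ Suc k) f x"
      by (simp add: Suc funpow_swap1 del: RW.C.simps)
    finally show ?case .
  qed
  have "(\<integral>\<^sup>+\<omega>. f (\<omega> n) \<partial>rw_law E c x) =
      (\<integral>\<^sup>+\<omega>. f (restrict \<omega> {0..<Suc n} n) \<partial>RW.PF.lim E c x)"
    by (simp add: rw_law_def)
  also have "\<dots> = (\<integral>\<^sup>+\<omega>. f (\<omega> n) \<partial>RW.CI E c x {0..<Suc n})"
    by (subst RW.distr_lim[symmetric], simp, subst nn_integral_distr)
       (auto intro!: meas measurable_restrict_subset simp: measurable_cong_sets[OF RW.PF.sets_lim])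
  also have "\<dots> = (\<integral>\<^sup>+\<omega>. f (\<omega> n) \<partial>RW.C E c x 0 (RW.up_to {0..<Suc n}) ?u)"
    unfolding RW.CI_def using RW.up_to[of "{0..<Suc n}"]
    apply (subst nn_integral_distr)
    apply (auto intro!: meas measurable_restrict_subset simp: measurable_cong_sets[OF RW.sets_C[OF u]])
    done
  also have "RW.up_to {0..<Suc n} = Suc n"
    by (rule antisym) (auto simp: RW.up_to_iff Suc_le_eq intro: RW.up_to_less)
  finally show ?thesis by (simp add: law del: RW.C.simps)
qed

text \<open>
  The charge \<open>\<phi>\<close> is divided by the total conductance so that a unit charge at \<open>y\<close> has the
  normalized Green's function as its potential, and so that the equation below reads like a discrete
  Poisson equation for the graph Laplacian.
\<close>

definition potential :: "'a set set \<Rightarrow> ('a set \<Rightarrow> real) \<Rightarrow> ('a \<Rightarrow> ennreal) \<Rightarrow> 'a \<Rightarrow> ennreal" where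
  "potential E c \<phi> x =
     (\<Sum>n. (step_mean E c ^^ n) (\<lambda>z. \<phi> z / ennreal (total_conductance E c z)) x)"

lemma step_mean_add: "step_mean E c (\<lambda>z. f z + g z) = (\<lambda>z. step_mean E c f z + step_mean E c g z)"
  by (simp add: step_mean_def fun_eq_iff nn_integral_add)

lemma step_mean_cmult: "step_mean E c (\<lambda>z. f z * a) = (\<lambda>z. step_mean E c f z * a)"
  by (simp add: step_mean_def fun_eq_iff nn_integral_multc)

lemma funpow_step_mean_add:
  "(step_mean E c ^^ n) (\<lambda>z. f z + g z) = (\<lambda>z. (step_mean E c ^^ n) f z + (step_mean E c ^^ n) g z)"
  by (induction n) (simp_all add: step_mean_add)

lemma funpow_step_mean_cmult:
  "(step_mean E c ^^ n) (\<lambda>z. f z * a) = (\<lambda>z. (step_mean E c ^^ n) f z * a)"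
  by (induction n) (simp_all add: step_mean_cmult)

lemma potential_add:
  "potential E c (\<lambda>z. \<phi> z + \<psi> z) x = potential E c \<phi> x + potential E c \<psi> x"
  by (simp add: potential_def add_divide_distrib_ennreal funpow_step_mean_add suminf_add)

lemma potential_sum:
  assumes "finite J"
  shows "potential E c (\<lambda>z. \<Sum>j\<in>J. \<phi> j z) x = (\<Sum>j\<in>J. potential E c (\<phi> j) x)"
  using assms
proof (induction J rule: finite_induct)
  case empty
  have "(step_mean E c ^^ n) (\<lambda>z. 0) = (\<lambda>z. 0)" for n
    by (induction n) (simp_all add: step_mean_def[abs_def])
  then show ?case by (simp add: potential_def)
qed (simp add: potential_add)

lemma green_eq_potential: "green E c x y = potential E c (indicator {y}) x"
proof -
  let ?p = "ennreal (total_conductance E c y)"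
  have meas: "(\<lambda>\<omega>. indicator {y} (\<omega> n) :: ennreal) \<in> borel_measurable (rw_law E c x)" for n :: nat
  proof -
    have "(\<lambda>\<omega>. \<omega> n) \<in> rw_law E c x \<rightarrow>\<^sub>M count_space UNIV"
      unfolding rw_law_def measurable_cong_sets[OF RW.PF.sets_lim refl]
      by (intro measurable_component_singleton) auto
    then show ?thesis by (rule measurable_compose) simp
  qed
  have "green E c x y = (\<Sum>n. (step_mean E c ^^ n) (indicator {y}) x) / ?p"
    unfolding green_def by (subst nn_integral_suminf[OF meas]) (simp add: nn_integral_rw_law)
  also have "\<dots> = (\<Sum>n. (step_mean E c ^^ n) (\<lambda>z. indicator {y} z * inverse ?p) x)"
    by (simp add: divide_ennreal_def funpow_step_mean_cmult)
  also have "(\<lambda>z. indicator {y} z * inverse ?p) =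
      (\<lambda>z. indicator {y} z / ennreal (total_conductance E c z))"
    by (auto simp: divide_ennreal_def fun_eq_iff indicator_def)
  finally show ?thesis by (simp add: potential_def)
qed

text \<open>
  First-step decomposition: the term for time \<open>0\<close> is split off, and the remaining series is the mean
  of the potential after one step.
\<close>

lemma potential_unfold:
  "potential E c \<phi> x = \<phi> x / ennreal (total_conductance E c x) + step_mean E c (potential E c \<phi>) x"
proof -
  let ?f = "\<lambda>z. \<phi> z / ennreal (total_conductance E c z)"
  have "potential E c \<phi> x = ?f x + (\<Sum>n. (step_mean E c ^^ Suc n) ?f x)"
    using suminf_offset[of "\<lambda>n. (step_mean E c ^^ n) ?f x" 1] by (simp add: potential_def)
  also have "(\<Sum>n. (step_mean E c ^^ Suc n) ?f x) = step_mean E c (potential E c \<phi>) x"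
    by (simp add: potential_def step_mean_def nn_integral_suminf)
  finally show ?thesis .
qed

text \<open>
  Vertices are confined to a set \<open>V\<close> that the walk cannot leave. Functions below are constrained on
  \<open>V\<close> only, so nothing has to be known about the junk values of the transition kernel elsewhere.
\<close>

locale conductance_network =
  fixes V :: "'a set" and E :: "'a set set" and c :: "'a set \<Rightarrow> real"
  assumes finite_nbrs: "x \<in> V \<Longrightarrow> finite {y. {x, y} \<in> E}"
    and nbrs_nonempty: "x \<in> V \<Longrightarrow> {y. {x, y} \<in> E} \<noteq> {}"
    and nbr_in_V: "{x, y} \<in> E \<Longrightarrow> y \<in> V"
    and conductance_pos: "{x, y} \<in> E \<Longrightarrow> 0 < c {x, y}"
begin

abbreviation "\<pi> \<equiv> total_conductance E c"

lemma total_conductance_pos: "x \<in> V \<Longrightarrow> 0 < \<pi> x"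
  unfolding total_conductance_def
  using finite_nbrs nbrs_nonempty conductance_pos by (intro sum_pos) auto

lemma total_conductance_mult_step_mean:
  assumes "x \<in> V"
  shows "ennreal (\<pi> x) * step_mean E c f x = (\<Sum>y | {x, y} \<in> E. ennreal (c {x, y}) * f y)"
proof -
  have pmf: "pmf (rw_step E c x) y = (if {x, y} \<in> E then c {x, y} / \<pi> x else 0)" for y
    using assms by (intro pmf_rw_step finite_nbrs nbrs_nonempty conductance_pos)
  let ?N = "{y. {x, y} \<in> E}"
  have "step_mean E c f x = (\<Sum>y\<in>?N. f y * ennreal (c {x, y} / \<pi> x))"
    unfolding step_mean_def
    by (subst nn_integral_measure_pmf_support[OF finite_nbrs[OF assms]])
       (auto simp: pmf set_pmf_iff split: if_splits intro!: sum.cong)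
  then have "ennreal (\<pi> x) * step_mean E c f x =
      (\<Sum>y\<in>?N. ennreal (\<pi> x) * (f y * ennreal (c {x, y} / \<pi> x)))"
    by (simp add: sum_distrib_left)
  also have "\<dots> = (\<Sum>y\<in>?N. ennreal (c {x, y}) * f y)"
  proof (intro sum.cong refl)
    fix y assume "y \<in> ?N"
    then have "ennreal (c {x, y}) = ennreal (\<pi> x) * ennreal (c {x, y} / \<pi> x)"
      using total_conductance_pos[OF assms] conductance_pos[of x y] by (simp flip: ennreal_mult)
    then show "ennreal (\<pi> x) * (f y * ennreal (c {x, y} / \<pi> x)) = ennreal (c {x, y}) * f y"
      by (simp add: mult_ac)
  qed
  finally show ?thesis .
qed

lemma total_conductance_mult_divide:
  "x \<in> V \<Longrightarrow> ennreal (\<pi> x) * (a / ennreal (\<pi> x)) = a"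
  using total_conductance_pos[of x]
  by (simp add: ennreal_times_divide ennreal_mult_divide_eq ennreal_divide_times mult.commute)

text \<open>
  The Poisson equation, multiplied out by the total conductance so that no division is left in
  \<open>[0, \<infinity>]\<close>.
\<close>

lemma potential_equation:
  assumes "x \<in> V"
  shows "ennreal (\<pi> x) * potential E c \<phi> x =
    \<phi> x + (\<Sum>y | {x, y} \<in> E. ennreal (c {x, y}) * potential E c \<phi> y)"
  by (subst potential_unfold)
     (simp add: distrib_left total_conductance_mult_step_mean total_conductance_mult_divide assms)

text \<open>
  The comparison principle on which the whole argument rests: the partial sums of the Green series
  arise from \<open>0\<close> by iterating the monotone map that sends \<open>h\<close> to the normalized charge plus the
  one-step mean of \<open>h\<close>, and a supersolution bounds every iterate.
\<close>

lemma potential_least: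
  assumes super: "\<And>x. x \<in> V \<Longrightarrow>
      \<phi> x + (\<Sum>y | {x, y} \<in> E. ennreal (c {x, y}) * f y) \<le> ennreal (\<pi> x) * f x"
    and "x \<in> V"
  shows "potential E c \<phi> x \<le> f x"
proof -
  let ?g = "\<lambda>z. \<phi> z / ennreal (\<pi> z)"
  have step: "?g x + step_mean E c h x \<le> f x"
    if "x \<in> V" and h: "\<And>y. y \<in> V \<Longrightarrow> h y \<le> f y" for x h
  proof -
    have "ennreal (\<pi> x) * (?g x + step_mean E c h x) =
        \<phi> x + (\<Sum>y | {x, y} \<in> E. ennreal (c {x, y}) * h y)"
      using that(1)
      by (simp add: distrib_left total_conductance_mult_step_mean total_conductance_mult_divide)
    also have "\<dots> \<le> \<phi> x + (\<Sum>y | {x, y} \<in> E. ennreal (c {x, y}) * f y)"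
      by (intro add_left_mono sum_mono mult_left_mono h) (auto dest: nbr_in_V)
    also have "\<dots> \<le> ennreal (\<pi> x) * f x"
      by (rule super[OF that(1)])
    finally show ?thesis
      using total_conductance_pos[OF that(1)]
      by (subst (asm) ennreal_mult_le_mult_iff) auto
  qed
  have "(\<Sum>k<n. (step_mean E c ^^ k) ?g x) \<le> f x" if "x \<in> V" for n x
    using that
  proof (induction n arbitrary: x)
    case (Suc n)
    have "(\<Sum>k<Suc n. (step_mean E c ^^ k) ?g x) =
        ?g x + step_mean E c (\<lambda>z. \<Sum>k<n. (step_mean E c ^^ k) ?g z) x"
      by (simp add: sum.lessThan_Suc_shift step_mean_def nn_integral_sum del: sum.lessThan_Suc)
    also have "\<dots> \<le> f x"
      using Suc by (intro step)
    finally show ?case .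
  qed simp
  then show ?thesis
    unfolding potential_def using assms(2)
    by (subst suminf_eq_SUP) (rule SUP_least)
qed

end


section \<open>Nearest-neighbour sums on lattices and orthants\<close>

definition move :: "(nat \<Rightarrow> real) \<Rightarrow> nat \<Rightarrow> real \<Rightarrow> nat \<Rightarrow> real" where
  "move x i s = x(i := x i + s)"

lemma move_in_zlattice:
  assumes "x \<in> zlattice d" "i \<in> {1..d}" "s \<in> {-1, 1}"
  shows "move x i s \<in> zlattice d"
proof -
  have "s \<in> \<int>" using assms(3) by auto
  then show ?thesis
    using assms by (auto simp: move_def zlattice_def PiE_iff extensional_def)
qed

text \<open>
  A vector of integers of Euclidean length \<open>1\<close> has one coordinate of modulus \<open>1\<close>, since the
  square of a nonzero integer is at least \<open>1\<close>, and the others vanish. So neighbours can be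
  enumerated by a coordinate direction and a sign, as the following sums do.
\<close>

lemma nn_edges_iff_move:
  assumes V: "V \<subseteq> zlattice d" and x: "x \<in> V"
  shows "{x, z} \<in> nn_edges d V \<longleftrightarrow> z \<in> V \<and> (\<exists>i\<in>{1..d}. \<exists>s\<in>{-1, 1}. z = move x i s)"
proof
  assume "{x, z} \<in> nn_edges d V"
  then have z: "z \<in> V" and
    "L2_set (\<lambda>i. x i - z i) {1..d} = 1 \<or> L2_set (\<lambda>i. z i - x i) {1..d} = 1"
    by (auto simp: nn_edges_def doubleton_eq_iff)
  moreover have "L2_set (\<lambda>i. x i - z i) {1..d} = L2_set (\<lambda>i. z i - x i) {1..d}"
    by (simp add: L2_set_def power2_commute)
  ultimately have sum: "(\<Sum>i\<in>{1..d}. (z i - x i)\<^sup>2) = 1"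
    by (auto simp: L2_set_def)
  then obtain i where i: "i \<in> {1..d}" "(z i - x i)\<^sup>2 \<noteq> 0"
    using sum.neutral[of "{1..d}" "\<lambda>i. (z i - x i)\<^sup>2"] by fastforce
  have int: "z j - x j \<in> \<int>" if "j \<in> {1..d}" for j
    using that z x V[THEN subsetD, of x] V[THEN subsetD, of z] by (auto simp: zlattice_def PiE_iff)
  have split: "(z i - x i)\<^sup>2 + (\<Sum>j\<in>{1..d}-{i}. (z j - x j)\<^sup>2) = 1"
    using sum i(1) by (subst (asm) sum.remove[of _ i]) auto
  have ge: "1 \<le> (z i - x i)\<^sup>2"
  proof -
    have "1 \<le> \<bar>z i - x i\<bar>"
      using int[OF i(1)] i(2) by (intro Ints_nonzero_abs_ge1) auto
    then show ?thesis using power_mono[of 1 "\<bar>z i - x i\<bar>" 2] by simp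
  qed
  have nn: "0 \<le> (\<Sum>j\<in>{1..d}-{i}. (z j - x j)\<^sup>2)" by (intro sum_nonneg) auto
  from split ge nn have one: "(z i - x i)\<^sup>2 = 1" and "(\<Sum>j\<in>{1..d}-{i}. (z j - x j)\<^sup>2) = 0"
    by linarith+
  then have eq: "z j = x j" if "j \<in> {1..d}" "j \<noteq> i" for j
    using that by (subst (asm) sum_nonneg_eq_0_iff) auto
  have "x \<in> extensional {1..d}" "z \<in> extensional {1..d}"
    using x z V by (auto simp: zlattice_def PiE_iff)
  then have "z j = x j" if "j \<noteq> i" for j
    using eq[of j] that by (cases "j \<in> {1..d}") (auto simp: extensional_def)
  then have "z = move x i (z i - x i)"
    by (auto simp: move_def fun_eq_iff)
  moreover have "z i - x i \<in> {-1, 1}" using one by (auto simp: power2_eq_1_iff)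
  ultimately show "z \<in> V \<and> (\<exists>i\<in>{1..d}. \<exists>s\<in>{-1, 1}. z = move x i s)"
    using z i(1) by blast
next
  assume "z \<in> V \<and> (\<exists>i\<in>{1..d}. \<exists>s\<in>{-1, 1}. z = move x i s)"
  then obtain i s where z: "z \<in> V" and i: "i \<in> {1..d}" and s: "s \<in> {-1, 1}" "z = move x i s"
    by blast
  have "(\<Sum>j\<in>{1..d}. (x j - z j)\<^sup>2) = (\<Sum>j\<in>{1..d}. if j = i then 1 else 0)"
    using s by (intro sum.cong) (auto simp: move_def)
  then have "L2_set (\<lambda>j. x j - z j) {1..d} = 1" using i by (simp add: L2_set_def)
  then show "{x, z} \<in> nn_edges d V" using x z unfolding nn_edges_def by blast
qed

lemma inj_on_move: "inj_on (\<lambda>(i, s). move x i s) (UNIV \<times> {-1, 1})"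
proof (rule inj_onI)
  fix p q assume *: "p \<in> UNIV \<times> {-1, 1::real}" "q \<in> UNIV \<times> {-1, 1::real}"
    "(case p of (i, s) \<Rightarrow> move x i s) = (case q of (i, s) \<Rightarrow> move x i s)"
  obtain i s j t where p: "p = (i, s)" "q = (j, t)" by (cases p, cases q)
  with * have st: "s \<noteq> 0" "t \<noteq> 0" and eq: "move x i s = move x j t" by auto
  have "i = j"
    using fun_cong[OF eq, of i] st by (auto simp: move_def split: if_splits)
  then show "p = q" using fun_cong[OF eq, of i] p by (auto simp: move_def)
qed

lemma sum_nn_neighbours:
  fixes F :: "(nat \<Rightarrow> real) \<Rightarrow> 'b::comm_monoid_add"
  assumes V: "V \<subseteq> zlattice d" and x: "x \<in> V"
  shows "(\<Sum>z | {x, z} \<in> nn_edges d V. F z) =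
    (\<Sum>i\<in>{1..d}. \<Sum>s\<in>{-1, 1}. if move x i s \<in> V then F (move x i s) else 0)"
proof -
  let ?S = "\<lambda>(i, s). move x i s"
  let ?P = "{p \<in> {1..d} \<times> {-1, 1}. ?S p \<in> V}"
  have "{z. {x, z} \<in> nn_edges d V} = ?S ` ?P"
    using nn_edges_iff_move[OF V x] by force
  moreover have "inj_on ?S ?P"
    by (rule inj_on_subset[OF inj_on_move]) auto
  ultimately have "(\<Sum>z | {x, z} \<in> nn_edges d V. F z) = (\<Sum>p\<in>?P. F (?S p))"
    by (simp add: sum.reindex o_def)
  also have "\<dots> = (\<Sum>p\<in>{1..d} \<times> {-1, 1}. if ?S p \<in> V then F (?S p) else 0)"
    by (intro sum.inter_filter) auto
  also have "\<dots> = (\<Sum>i\<in>{1..d}. \<Sum>s\<in>{-1, 1}. if move x i s \<in> V then F (move x i s) else 0)"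
    unfolding sum.cartesian_product by (intro sum.cong) auto
  finally show ?thesis .
qed

lemma conductance_network_partial_orthant:
  assumes "1 \<le> d"
  shows "conductance_network (partial_orthant d m) (nn_edges d (partial_orthant d m)) (\<lambda>_. 1)"
proof
  fix x y assume "{x, y} \<in> nn_edges d (partial_orthant d m)"
  then show "y \<in> partial_orthant d m" by (auto simp: nn_edges_def doubleton_eq_iff)
next
  fix x assume "x \<in> partial_orthant d m"
  show "finite {y. {x, y} \<in> nn_edges d (partial_orthant d m)}"
    by (rule finite_nn_neighbours[OF partial_orthant_subset])
  show "{y. {x, y} \<in> nn_edges d (partial_orthant d m)} \<noteq> {}"
    by (rule partial_orthant_has_neighbour) fact+
qed simp

abbreviation nn_potential ::
  "nat \<Rightarrow> (nat \<Rightarrow> real) set \<Rightarrow> ((nat \<Rightarrow> real) \<Rightarrow> ennreal) \<Rightarrow> (nat \<Rightarrow> real) \<Rightarrow> ennreal" where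
  "nn_potential d V \<equiv> potential (nn_edges d V) (\<lambda>_. 1)"

text \<open>
  A step that would leave \<open>V\<close> is replaced by holding still. On an orthant this gives the lazy walk
  in which every vertex has the \<open>2d\<close> outcomes of the full lattice. Holding does not change the
  normalized Green's function, and the lazy walk is the one that folding the lattice produces.
\<close>

definition stay :: "'a set \<Rightarrow> 'a \<Rightarrow> 'a \<Rightarrow> 'a" where
  "stay V x z = (if z \<in> V then z else x)"

text \<open>
  The number \<open>\<kappa>\<close> of forbidden steps at \<open>x\<close> makes up the difference between the degree and \<open>2d\<close>;
  it contributes \<open>\<kappa> * F x\<close> to both sides of an equation and can therefore be cancelled where
  \<open>F x\<close> is finite.
\<close>

lemma holding_weight:
  assumes V: "V \<subseteq> zlattice d" and x: "x \<in> V"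
  shows "\<exists>\<kappa>. \<kappa> < \<infinity> \<and> ennreal (total_conductance (nn_edges d V) (\<lambda>_. 1) x) + \<kappa> = of_nat (2 * d) \<and>
    (\<forall>F :: _ \<Rightarrow> ennreal. (\<Sum>i\<in>{1..d}. \<Sum>s\<in>{-1, 1}. F (stay V x (move x i s))) =
      (\<Sum>z | {x, z} \<in> nn_edges d V. F z) + \<kappa> * F x)"
proof -
  define \<kappa> :: ennreal where
    "\<kappa> = (\<Sum>i\<in>{1..d}. \<Sum>s\<in>{-1, 1}. if move x i s \<in> V then 0 else 1)"
  have F: "(\<Sum>i\<in>{1..d}. \<Sum>s\<in>{-1, 1}. F (stay V x (move x i s))) =
      (\<Sum>z | {x, z} \<in> nn_edges d V. F z) + \<kappa> * F x" for F :: "_ \<Rightarrow> ennreal"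
  proof -
    let ?in = "\<lambda>i s. if move x i s \<in> V then F (move x i s) else 0"
      and ?out = "\<lambda>i s. (if move x i s \<in> V then 0 else 1) * F x"
    have "(\<Sum>i\<in>{1..d}. \<Sum>s\<in>{-1, 1}. F (stay V x (move x i s))) =
        (\<Sum>i\<in>{1..d}. \<Sum>s\<in>{-1, 1}. ?in i s + ?out i s)"
      by (intro sum.cong refl) (simp add: stay_def)
    also have "\<dots> = (\<Sum>i\<in>{1..d}. \<Sum>s\<in>{-1, 1}. ?in i s) + (\<Sum>i\<in>{1..d}. \<Sum>s\<in>{-1, 1}. ?out i s)"
      by (simp only: sum.distrib)
    also have "(\<Sum>i\<in>{1..d}. \<Sum>s\<in>{-1, 1}. ?out i s) = \<kappa> * F x"
      by (simp only: \<kappa>_def sum_distrib_right)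
    finally show ?thesis by (simp only: sum_nn_neighbours[OF assms])
  qed
  have "ennreal (total_conductance (nn_edges d V) (\<lambda>_. 1) x) = (\<Sum>z | {x, z} \<in> nn_edges d V. 1)"
    by (simp add: total_conductance_def ennreal_of_nat_eq_real_of_nat)
  then have "ennreal (total_conductance (nn_edges d V) (\<lambda>_. 1) x) + \<kappa> =
      (\<Sum>i\<in>{1..d}. \<Sum>s\<in>{-1, 1::real}. 1)"
    using F[of "\<lambda>_. 1"] by simp
  then have eq: "ennreal (total_conductance (nn_edges d V) (\<lambda>_. 1) x) + \<kappa> = of_nat (2 * d)"
    by (simp add: mult.commute)
  have "\<kappa> \<le> of_nat (2 * d)" unfolding eq[symmetric] by simp
  then have fin: "\<kappa> < \<infinity>" using of_nat_less_top[of "2*d"] by (auto simp: infinity_ennreal_def elim: order_le_less_trans)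
  show ?thesis
    using fin eq F by (intro exI[of _ \<kappa>] conjI allI)
qed

text \<open>
  Adding \<open>\<kappa>\<close> times the potential to both sides of the Poisson equation turns it into the equation
  of the lazy walk.
\<close>

lemma nn_potential_equation:
  fixes d m :: nat
  assumes "1 \<le> d" and x: "x \<in> partial_orthant d m"
  defines "V \<equiv> partial_orthant d m"
  shows "of_nat (2 * d) * nn_potential d V \<phi> x =
    \<phi> x + (\<Sum>i\<in>{1..d}. \<Sum>s\<in>{-1, 1}. nn_potential d V \<phi> (stay V x (move x i s)))"
proof -
  interpret conductance_network V "nn_edges d V" "\<lambda>_. 1"
    unfolding V_def by (rule conductance_network_partial_orthant) fact
  have xV: "x \<in> V" and V: "V \<subseteq> zlattice d" using x by (auto simp: V_def intro: partial_orthant_subset[THEN subsetD])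
  obtain \<kappa> where \<kappa>: "ennreal (\<pi> x) + \<kappa> = of_nat (2 * d)"
    "\<And>F :: _ \<Rightarrow> ennreal. (\<Sum>i\<in>{1..d}. \<Sum>s\<in>{-1, 1}. F (stay V x (move x i s))) =
      (\<Sum>z | {x, z} \<in> nn_edges d V. F z) + \<kappa> * F x"
    using holding_weight[OF V xV] by auto
  show ?thesis
    unfolding \<kappa>(1)[symmetric] \<kappa>(2)[of "nn_potential d V \<phi>"] distrib_right potential_equation[OF xV] by (simp add: add.assoc)
qed

text \<open>
  The comparison principle for the lazy walk. It comes from \<open>potential_least\<close> by subtracting the
  holding term \<open>\<kappa> * f x\<close>, which is why \<open>f\<close> is required to be finite.
\<close>

lemma nn_potential_least:
  fixes d m :: nat
  assumes "1 \<le> d"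
  defines "V \<equiv> partial_orthant d m"
  assumes fin: "\<And>x. x \<in> V \<Longrightarrow> f x < \<infinity>"
    and super: "\<And>x. x \<in> V \<Longrightarrow>
      \<phi> x + (\<Sum>i\<in>{1..d}. \<Sum>s\<in>{-1, 1}. f (stay V x (move x i s))) \<le> of_nat (2 * d) * f x"
    and x: "x \<in> V"
  shows "nn_potential d V \<phi> x \<le> f x"
proof -
  interpret conductance_network V "nn_edges d V" "\<lambda>_. 1"
    unfolding V_def by (rule conductance_network_partial_orthant) fact
  have V: "V \<subseteq> zlattice d" by (simp add: V_def partial_orthant_subset)
  show ?thesis
  proof (rule potential_least[OF _ x])
    fix x assume x: "x \<in> V"
    obtain \<kappa> where \<kappa>: "\<kappa> < \<infinity>" "ennreal (\<pi> x) + \<kappa> = of_nat (2 * d)"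
      "\<And>F :: _ \<Rightarrow> ennreal. (\<Sum>i\<in>{1..d}. \<Sum>s\<in>{-1, 1}. F (stay V x (move x i s))) =
        (\<Sum>z | {x, z} \<in> nn_edges d V. F z) + \<kappa> * F x"
      using holding_weight[OF V x] by auto
    have "\<phi> x + (\<Sum>z | {x, z} \<in> nn_edges d V. f z) + \<kappa> * f x \<le> ennreal (\<pi> x) * f x + \<kappa> * f x"
      using super[OF x] unfolding \<kappa>(2)[symmetric] \<kappa>(3)[of f] distrib_right by (simp add: add.assoc)
    moreover have "\<kappa> * f x < \<infinity>"
      using \<kappa>(1) fin[OF x] by (simp add: ennreal_mult_less_top)
    ultimately have "\<phi> x + (\<Sum>z | {x, z} \<in> nn_edges d V. f z) \<le> ennreal (\<pi> x) * f x"
      by (subst (asm) (1 2) add.commute[of _ "\<kappa> * f x"], subst (asm) ennreal_add_left_cancel_le) auto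
    then show "\<phi> x + (\<Sum>z | {x, z} \<in> nn_edges d V. ennreal 1 * f z) \<le> ennreal (\<pi> x) * f x"
      by simp
  qed
qed

lemma stay_zlattice:
  "x \<in> zlattice d \<Longrightarrow> i \<in> {1..d} \<Longrightarrow> s \<in> {-1, 1} \<Longrightarrow> stay (zlattice d) x (move x i s) = move x i s"
  by (simp add: stay_def move_in_zlattice)

lemma sum_stay_zlattice:
  assumes "x \<in> zlattice d"
  shows "(\<Sum>i\<in>{1..d}. \<Sum>s\<in>{-1, 1}. f (stay (zlattice d) x (move x i s))) =
    (\<Sum>i\<in>{1..d}. \<Sum>s\<in>{-1, 1}. f (move x i s))"
  by (intro sum.cong refl arg_cong[where f = f] stay_zlattice[OF assms])

lemma nn_potential_zlattice_equation:
  assumes "1 \<le> d" "x \<in> zlattice d"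
  shows "of_nat (2 * d) * nn_potential d (zlattice d) \<phi> x =
    \<phi> x + (\<Sum>i\<in>{1..d}. \<Sum>s\<in>{-1, 1}. nn_potential d (zlattice d) \<phi> (move x i s))"
proof -
  have x: "x \<in> partial_orthant d 0" using assms(2) by (simp only: partial_orthant_0)
  show ?thesis
    using nn_potential_equation[OF assms(1) x, of \<phi>]
    unfolding partial_orthant_0 sum_stay_zlattice[OF assms(2), of "nn_potential d (zlattice d) \<phi>"] .
qed

lemma nn_potential_zlattice_least:
  assumes "1 \<le> d"
    and "\<And>x. x \<in> zlattice d \<Longrightarrow> f x < \<infinity>"
    and "\<And>x. x \<in> zlattice d \<Longrightarrow>
      \<phi> x + (\<Sum>i\<in>{1..d}. \<Sum>s\<in>{-1, 1}. f (move x i s)) \<le> of_nat (2 * d) * f x"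
    and "x \<in> zlattice d"
  shows "nn_potential d (zlattice d) \<phi> x \<le> f x"
proof -
  have "nn_potential d (partial_orthant d 0) \<phi> x \<le> f x"
  proof (rule nn_potential_least[OF assms(1)], unfold partial_orthant_0)
    fix x assume x: "x \<in> zlattice d"
    show "f x < \<infinity>" by (rule assms(2)[OF x])
    show "\<phi> x + (\<Sum>i\<in>{1..d}. \<Sum>s\<in>{-1, 1}. f (stay (zlattice d) x (move x i s))) \<le> of_nat (2 * d) * f x"
      unfolding sum_stay_zlattice[OF x, of f] by (rule assms(3)[OF x])
  qed (rule assms(4))
  then show ?thesis by (simp only: partial_orthant_0)
qed

lemma nn_green_eq_potential: "nn_green d V x y = nn_potential d V (indicator {y}) x"
  by (simp add: nn_green_def green_eq_potential)


section \<open>Transience in dimension at least three\<close>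

text \<open>
  A Taylor polynomial of \<open>1 / sqrt (1 + u)\<close> whose quartic coefficient \<open>35/128\<close> has been raised to \<open>1/2\<close>
  in order to dominate the remainder. Squaring makes the claim polynomial, and the difference is
  \<open>u\<^sup>4\<close> times a quintic that is positive on the interval.
\<close>

lemma inverse_sqrt_quartic_bound:
  fixes u :: real
  assumes "\<bar>u\<bar> \<le> 9/20"
  shows "1 / sqrt (1 + u) \<le> 1 - u/2 + 3/8*u^2 - 5/16*u^3 + u^4/2"
proof -
  let ?p = "1 - u/2 + 3/8*u^2 - 5/16*u^3 + u^4/2"
  have pw: "\<bar>u^k\<bar> \<le> (9/20)^k" for k
    using power_mono[OF assms, of k] by (simp add: power_abs)
  have b: "\<bar>u\<bar> \<le> 9/20" "\<bar>u^2\<bar> \<le> 81/400" "\<bar>u^3\<bar> \<le> 729/8000" "\<bar>u^4\<bar> \<le> 6561/160000"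
    "\<bar>u^5\<bar> \<le> 59049/3200000"
    using assms pw[of 2] pw[of 3] pw[of 4] pw[of 5] by (simp_all add: power_divide)
  have p: "0 < ?p" using b by linarith
  \<comment> \<open>The quotient of \<open>(1 + u) * ?p\<^sup>2 - 1\<close> by \<open>u\<^sup>4\<close>.\<close>
  have q: "0 \<le> 29/64 + 46/64*u - 67/256*u^2 + 41/256*u^3 - u^4/16 + u^5/4"
    using b by linarith
  have "0 \<le> u^4 * (29/64 + 46/64*u - 67/256*u^2 + 41/256*u^3 - u^4/16 + u^5/4)"
    by (rule mult_nonneg_nonneg[OF zero_le_even_power q]) simp
  also have "\<dots> = (1 + u) * ?p^2 - 1"
    by (simp add: field_simps eval_nat_numeral)
  finally have "1 \<le> (1 + u) * ?p^2" by simp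
  then have "sqrt 1 \<le> sqrt ((1 + u) * ?p^2)" by (rule real_sqrt_le_mono)
  also have "\<dots> = sqrt (1 + u) * ?p" using p by (simp add: real_sqrt_mult)
  finally show ?thesis using b by (simp add: divide_le_eq mult.commute)
qed

text \<open>
  With \<open>u = 2a/A\<close> the odd powers of \<open>u\<close> cancel. The hypothesis gives \<open>\<bar>u\<bar> \<le> 1 / sqrt 6\<close>,
  which is less than \<open>9/20\<close>.
\<close>

lemma inverse_sqrt_symmetric_sum_bound:
  fixes A a :: real
  assumes "6 + a^2 \<le> A"
  shows "1 / sqrt (A + 2*a) + 1 / sqrt (A - 2*a) \<le> (2 + 3*a^2/A^2 + 16*a^4/A^4) / sqrt A"
proof -
  define u where "u = 2*a/A"
  have A: "0 < A" using assms zero_le_power2[of a] by linarith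
  have "40 * a \<le> 54 + 9*a^2" "- 40 * a \<le> 54 + 9*a^2"
    using zero_le_power2[of "3*a - 20/3"] zero_le_power2[of "3*a + 20/3"]
    by (auto simp: power2_eq_square algebra_simps)
  then have "40 * \<bar>a\<bar> \<le> 9 * A" using assms by (auto simp: abs_if)
  then have u: "\<bar>u\<bar> \<le> 9/20" using A by (simp add: u_def abs_mult field_simps)
  have "A + 2*a = A * (1 + u)" "A - 2*a = A * (1 + - u)" using A by (simp_all add: u_def field_simps)
  then have "1 / sqrt (A + 2*a) + 1 / sqrt (A - 2*a) = (1 / sqrt (1 + u) + 1 / sqrt (1 + - u)) / sqrt A"
    by (simp add: real_sqrt_mult add_divide_distrib mult.commute)
  also have "\<dots> \<le> (2 + 3/4*u^2 + u^4) / sqrt A"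
    using inverse_sqrt_quartic_bound[of u] inverse_sqrt_quartic_bound[of "-u"] u A
    by (intro divide_right_mono) auto
  also have "2 + 3/4*u^2 + u^4 = 2 + 3*a^2/A^2 + 16*a^4/A^4"
    by (simp add: u_def power_divide power_mult_distrib)
  finally show ?thesis .
qed

text \<open>
  The function \<open>1 / sqrt (5 + \<bar>a\<bar>\<^sup>2)\<close> is superharmonic on the three-dimensional lattice: it is the
  Newtonian kernel \<open>1/\<bar>a\<bar>\<close> regularized at the origin. To leading order the six neighbours average to
  the value at the centre; the constant \<open>5\<close> is large enough for the gain from the regularization to
  absorb the quartic error terms of the expansion.
\<close>

lemma inverse_sqrt_superharmonic:
  fixes a :: "nat \<Rightarrow> real"
  defines "r \<equiv> (\<Sum>i\<in>{1..3}. (a i)^2)"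
  shows "(\<Sum>i\<in>{1..3}. 1 / sqrt (6 + r + 2 * a i) + 1 / sqrt (6 + r - 2 * a i)) \<le> 6 / sqrt (5 + r)"
proof -
  define A where "A = 6 + r"
  have r: "0 \<le> r" by (simp add: r_def sum_nonneg)
  have A: "6 \<le> A" using r by (simp add: A_def)
  have le: "(a i)^2 \<le> r" if "i \<in> {1..3}" for i
    unfolding r_def using that by (intro member_le_sum) auto
  have "(\<Sum>i\<in>{1..3}. 1 / sqrt (A + 2 * a i) + 1 / sqrt (A - 2 * a i))
      \<le> (\<Sum>i\<in>{1..3}. (2 + 3*(a i)^2/A^2 + 16*(a i)^4/A^4) / sqrt A)"
    using le by (intro sum_mono inverse_sqrt_symmetric_sum_bound) (auto simp: A_def)
  also have "\<dots> = (6 + 3*r/A^2 + 16*(\<Sum>i\<in>{1..3}. (a i)^4)/A^4) / sqrt A"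
    by (simp add: r_def sum_divide_distrib sum.distrib sum_distrib_left add_divide_distrib)
  also have "\<dots> \<le> (6 + 3/A) / sqrt A"
  proof -
    have "(\<Sum>i\<in>{1..3}. (a i)^4) \<le> (\<Sum>i\<in>{1..3}. r * (a i)^2)"
    proof (rule sum_mono)
      fix i :: nat assume "i \<in> {1..3}"
      then have "(a i)^2 * (a i)^2 \<le> r * (a i)^2" by (intro mult_right_mono le) auto
      then show "(a i)^4 \<le> r * (a i)^2" by (simp flip: power_add)
    qed
    also have "\<dots> = r * r" by (simp add: r_def sum_distrib_left)
    finally have 4: "(\<Sum>i\<in>{1..3}. (a i)^4) \<le> r * r" .
    have "r * r \<le> A * A" using r by (intro mult_mono) (auto simp: A_def)
    then have "3 * r * A^2 + 16 * (r * r) \<le> 3 * A^3"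
      by (simp add: A_def power2_eq_square power3_eq_cube algebra_simps)
    with 4 have "3 * r * A^2 + 16 * (\<Sum>i\<in>{1..3}. (a i)^4) \<le> 3 * A^3" by linarith
    then have "(3 * r * A^2 + 16 * (\<Sum>i\<in>{1..3}. (a i)^4)) / A^4 \<le> 3 * A^3 / A^4"
      using A by (intro divide_right_mono) auto
    then have "3*r/A^2 + 16*(\<Sum>i\<in>{1..3}. (a i)^4)/A^4 \<le> 3/A"
      using A by (simp add: add_divide_distrib power2_eq_square power3_eq_cube power4_eq_xxxx)
    then show ?thesis using A by (intro divide_right_mono) auto
  qed
  also have "\<dots> \<le> 6 / sqrt (A - 1)"
  proof -
    have "(1 + 1/(2*A))^2 * (A - 1) = A - (3 / (4*A) + 1 / (4*A^2))"
      using A by (simp add: power2_eq_square field_simps)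
    also have "\<dots> \<le> A"
    proof -
      have "0 \<le> 3 / (4*A) + 1 / (4*A^2)" using A by (intro add_nonneg_nonneg) auto
      then show ?thesis by linarith
    qed
    finally have "sqrt ((1 + 1/(2*A))^2 * (A - 1)) \<le> sqrt A" by (rule real_sqrt_le_mono)
    then have "(1 + 1/(2*A)) * sqrt (A - 1) \<le> sqrt A"
      using A by (simp add: real_sqrt_mult)
    then have "(6 + 3/A) * sqrt (A - 1) \<le> 6 * sqrt A"
      by (simp add: algebra_simps)
    then show ?thesis using A by (simp add: field_simps)
  qed
  finally show ?thesis by (simp add: A_def)
qed

text \<open>
  Transience in dimension at least three. The superharmonic function of the first three coordinates of
  \<open>x - y\<close> is superharmonic in all \<open>d\<close> coordinates, as steps in the others do not change it. At
  \<open>x = y\<close> it exceeds its average by a definite amount, so a multiple of it is a finite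
  supersolution for the unit charge at \<open>y\<close>.
\<close>

lemma nn_potential_zlattice_finite:
  assumes d: "3 \<le> d" and x: "x \<in> zlattice d" and y: "y \<in> zlattice d"
  shows "nn_potential d (zlattice d) (indicator {y}) x < \<infinity>"
proof -
  define T where "T x = (\<Sum>j\<in>{1..3}. (x j - y j)\<^sup>2)" for x :: "nat \<Rightarrow> real"
  define F where "F x = 1 / sqrt (5 + T x)" for x
  \<comment> \<open>The excess of \<open>2 * d * F\<close> over the sum of its neighbouring values at \<open>y\<close>: there \<open>T\<close> is \<open>0\<close>,
    and it is \<open>1\<close> at the six neighbours in the first three directions.\<close>
  define \<epsilon> :: real where "\<epsilon> = 6 / sqrt 5 - 6 / sqrt 6"
  have T: "0 \<le> T x" for x by (simp add: T_def sum_nonneg)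
  have F: "0 < F x" for x using T[of x] by (simp add: F_def)
  have \<epsilon>: "0 < \<epsilon>" by (simp add: \<epsilon>_def field_simps)
  have T_move: "T (move x i s) = 1 + T x + 2 * s * (x i - y i)"
    if "i \<in> {1..3}" "s \<in> {-1, 1}" for x i s
  proof -
    have "T (move x i s) = (x i + s - y i)\<^sup>2 + (\<Sum>j\<in>{1..3}-{i}. (x j - y j)\<^sup>2)"
      unfolding T_def using that by (subst sum.remove[of _ i]) (auto simp: move_def)
    moreover have "T x = (x i - y i)\<^sup>2 + (\<Sum>j\<in>{1..3}-{i}. (x j - y j)\<^sup>2)"
      unfolding T_def using that by (subst sum.remove[of _ i]) auto
    moreover have "(x i + s - y i)\<^sup>2 = (x i - y i)\<^sup>2 + 1 + 2 * s * (x i - y i)"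
      using that by (auto simp: power2_eq_square algebra_simps)
    ultimately show ?thesis by simp
  qed
  have T_move': "T (move x i s) = T x" if "3 < i" for x i s
    unfolding T_def using that by (intro sum.cong) (auto simp: move_def)
  have super: "\<epsilon> * indicator {y} x + (\<Sum>i\<in>{1..d}. \<Sum>s\<in>{-1, 1}. F (move x i s)) \<le> 2 * d * F x" for x
  proof -
    have "{1..d} = {1..3} \<union> {4..d}" using d by auto
    then have "(\<Sum>i\<in>{1..d}. \<Sum>s\<in>{-1, 1}. F (move x i s)) =
        (\<Sum>i\<in>{1..3}. \<Sum>s\<in>{-1, 1}. F (move x i s)) + (\<Sum>i\<in>{4..d}. \<Sum>s\<in>{-1, 1}. F (move x i s))"
      by (simp only:) (intro sum.union_disjoint, auto)
    also have "(\<Sum>i\<in>{4..d}. \<Sum>s\<in>{-1, 1}. F (move x i s)) = (\<Sum>i\<in>{4..d}. 2 * F x)"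
      by (intro sum.cong refl) (simp add: F_def T_move')
    also have "\<dots> = (2 * real d - 6) * F x" using d by (simp add: of_nat_diff left_diff_distrib algebra_simps)
    also have "(\<Sum>i\<in>{1..3}. \<Sum>s\<in>{-1, 1}. F (move x i s)) =
        (\<Sum>i\<in>{1..3}. 1 / sqrt (6 + T x + 2 * (x i - y i)) + 1 / sqrt (6 + T x - 2 * (x i - y i)))"
      by (intro sum.cong refl) (simp add: F_def T_move algebra_simps)
    finally have sum: "(\<Sum>i\<in>{1..d}. \<Sum>s\<in>{-1, 1}. F (move x i s)) =
        (\<Sum>i\<in>{1..3}. 1 / sqrt (6 + T x + 2 * (x i - y i)) + 1 / sqrt (6 + T x - 2 * (x i - y i)))
        + (2 * real d - 6) * F x" .
    show ?thesis
    proof (cases "x = y")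
      case True
      then show ?thesis unfolding sum by (simp add: T_def F_def \<epsilon>_def algebra_simps)
    next
      case False
      have "(\<Sum>i\<in>{1..3}. 1 / sqrt (6 + T x + 2 * (x i - y i)) + 1 / sqrt (6 + T x - 2 * (x i - y i)))
          \<le> 6 * F x"
        using inverse_sqrt_superharmonic[of "\<lambda>i. x i - y i"] by (simp add: F_def T_def)
      moreover have "(2 * real d - 6) * F x = 2 * d * F x - 6 * F x" by (simp add: algebra_simps)
      ultimately show ?thesis unfolding sum using False by simp
    qed
  qed
  have "nn_potential d (zlattice d) (indicator {y}) x \<le> ennreal (F x / \<epsilon>)"
  proof (rule nn_potential_zlattice_least[OF _ _ _ x])
    fix x assume "x \<in> zlattice d"
    have "indicator {y} x + (\<Sum>i\<in>{1..d}. \<Sum>s\<in>{-1, 1}. ennreal (F (move x i s) / \<epsilon>)) =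
        ennreal (indicator {y} x + (\<Sum>i\<in>{1..d}. \<Sum>s\<in>{-1, 1}. F (move x i s) / \<epsilon>))"
      using F \<epsilon>
      by (subst ennreal_plus)
         (simp_all add: ennreal_indicator sum_nonneg order.strict_implies_order del: sum.insert)
    also have "\<dots> = ennreal ((\<epsilon> * indicator {y} x + (\<Sum>i\<in>{1..d}. \<Sum>s\<in>{-1, 1}. F (move x i s))) / \<epsilon>)"
      using \<epsilon> by (simp add: sum_divide_distrib add_divide_distrib del: sum.insert)
    also have "\<dots> \<le> ennreal (2 * d * F x / \<epsilon>)"
      using \<epsilon> super[of x] by (intro ennreal_leI divide_right_mono) auto
    also have "\<dots> = of_nat (2 * d) * ennreal (F x / \<epsilon>)"
      using F[of x] \<epsilon> by (simp add: ennreal_of_nat_eq_real_of_nat flip: ennreal_mult)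
    finally show "indicator {y} x + (\<Sum>i\<in>{1..d}. \<Sum>s\<in>{-1, 1}. ennreal (F (move x i s) / \<epsilon>))
        \<le> of_nat (2 * d) * ennreal (F x / \<epsilon>)" .
  qed (use d in auto)
  then show ?thesis by (rule order_le_less_trans) simp
qed


section \<open>Folding the lattice onto the orthant\<close>

lemma Ints_negative_le: "(t::real) \<in> \<int> \<Longrightarrow> t < 0 \<Longrightarrow> t \<le> -1"
  by (elim Ints_cases) simp

lemma Nats_iff_Ints_nonneg: "(t::real) \<in> \<nat> \<longleftrightarrow> t \<in> \<int> \<and> 0 \<le> t"
  by (auto simp: Nats_altdef2)

lemma partial_orthant_iff:
  "x \<in> partial_orthant d m \<longleftrightarrow> x \<in> zlattice d \<and> (\<forall>i\<in>{1..d}. i \<le> m \<longrightarrow> 0 \<le> x i)"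
  unfolding partial_orthant_def zlattice_def by (auto simp: PiE_iff Nats_iff_Ints_nonneg)

text \<open>
  The reflection in the hyperplane where coordinate \<open>i\<close> equals \<open>-1/2\<close>, halfway between the face of
  the orthant and the layer just outside.
\<close>

definition mirror :: "nat \<Rightarrow> (nat \<Rightarrow> real) \<Rightarrow> nat \<Rightarrow> real" where
  "mirror i x = x(i := - 1 - x i)"

lemma mirror_mirror: "mirror i (mirror i x) = x"
  by (simp add: mirror_def)

lemma mirror_in_zlattice: "x \<in> zlattice d \<Longrightarrow> i \<in> {1..d} \<Longrightarrow> mirror i x \<in> zlattice d"
  by (auto simp: mirror_def zlattice_def PiE_iff extensional_def)

lemma move_mirror: "move (mirror i x) j s = mirror i (move x j (if j = i then - s else s))"
  by (auto simp: mirror_def move_def fun_eq_iff)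

text \<open>
  A step leaves the orthant only through a face on which the vertex lies, and it ends at the mirror
  image of the vertex. This is the reason for reflecting at \<open>-1/2\<close> rather than at \<open>0\<close>.
\<close>

lemma move_outside_partial_orthant:
  assumes x: "x \<in> partial_orthant d m" and i: "i \<in> {1..d}" and s: "s \<in> {-1, 1}"
    and out: "move x i s \<notin> partial_orthant d m"
  shows "i \<le> m" and "move x i s = mirror i x"
proof -
  have xz: "x \<in> zlattice d" using x by (simp add: partial_orthant_iff)
  have neg: "i \<le> m \<and> x i + s < 0"
    using out move_in_zlattice[OF xz i s] x
    by (auto simp: partial_orthant_iff move_def split: if_splits)
  then have "0 \<le> x i" "x i \<in> \<int>" using x i by (auto simp: partial_orthant_iff zlattice_def)
  with neg have "x i = 0" "s = -1" using s Ints_negative_le[of "x i - 1"] by auto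
  then show "move x i s = mirror i x" by (simp add: move_def mirror_def)
  show "i \<le> m" using neg by simp
qed

definition fold_orthant :: "nat \<Rightarrow> nat \<Rightarrow> (nat \<Rightarrow> real) \<Rightarrow> nat \<Rightarrow> real" where
  "fold_orthant d m x = (\<lambda>i\<in>{1..d}. if i \<le> m \<and> x i < 0 then - 1 - x i else x i)"

lemma fold_orthant_in: "x \<in> zlattice d \<Longrightarrow> fold_orthant d m x \<in> partial_orthant d m"
  unfolding partial_orthant_iff
  by (auto simp: fold_orthant_def zlattice_def PiE_iff dest!: Ints_negative_le)

lemma fold_orthant_id: "x \<in> partial_orthant d m \<Longrightarrow> fold_orthant d m x = x"
  unfolding partial_orthant_iff
  by (auto simp: fold_orthant_def zlattice_def PiE_iff extensional_def fun_eq_iff)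

lemma fold_orthant_mirror:
  "x \<in> zlattice d \<Longrightarrow> i \<in> {1..d} \<Longrightarrow> i \<le> m \<Longrightarrow> fold_orthant d m (mirror i x) = fold_orthant d m x"
  by (auto simp: mirror_def fold_orthant_def fun_eq_iff zlattice_def PiE_iff dest!: Ints_negative_le bspec)

text \<open>
  Folding back a step that leaves the orthant returns the walk to its starting point, as in the lazy
  walk.
\<close>

lemma fold_orthant_move_stay:
  assumes x: "x \<in> partial_orthant d m" and i: "i \<in> {1..d}" and s: "s \<in> {-1, 1}"
  shows "fold_orthant d m (move x i s) = stay (partial_orthant d m) x (move x i s)"
proof (cases "move x i s \<in> partial_orthant d m")
  case False
  have "x \<in> zlattice d" using x by (simp add: partial_orthant_iff)
  then show ?thesis
    using move_outside_partial_orthant[OF x i s False] False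
    by (simp add: stay_def fold_orthant_mirror[OF _ i] fold_orthant_id[OF x])
qed (simp add: stay_def fold_orthant_id)

text \<open>
  Folding is compatible with moves up to the sign of the step, which is reversed in a reflected
  coordinate. Hence the folded lattice walk is Markov: it is the lazy walk on the orthant.
\<close>

lemma fold_orthant_move:
  assumes x: "x \<in> zlattice d" and i: "i \<in> {1..d}" and s: "s \<in> {-1, 1}"
  shows "fold_orthant d m (move x i s) =
    fold_orthant d m (move (fold_orthant d m x) i (if i \<le> m \<and> x i < 0 then - s else s))"
proof
  fix j
  show "fold_orthant d m (move x i s) j =
    fold_orthant d m (move (fold_orthant d m x) i (if i \<le> m \<and> x i < 0 then - s else s)) j"
  proof (cases "j \<in> {1..d}")
    case True
    \<comment> \<open>No integer lies strictly between \<open>-1\<close> and \<open>0\<close>, so exactly one of \<open>t\<close> and \<open>- 1 - t\<close> is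
      nonnegative when \<open>t\<close> is a coordinate of a lattice point.\<close>
    have "x j \<in> \<int>" "s \<in> \<int>" using x True s by (auto simp: zlattice_def)
    then have "x j + s \<in> \<int>" by simp
    show ?thesis
      using Ints_negative_le[OF \<open>x j \<in> \<int>\<close>] Ints_negative_le[OF \<open>x j + s \<in> \<int>\<close>] True i
      by (auto simp: fold_orthant_def move_def)
  next
    case False
    then show ?thesis by (simp only: fold_orthant_def restrict_apply if_False)
  qed
qed

lemma sum_fold_orthant_move:
  fixes F :: "_ \<Rightarrow> ennreal"
  assumes x: "x \<in> zlattice d" and i: "i \<in> {1..d}"
  shows "(\<Sum>s\<in>{-1, 1}. F (fold_orthant d m (move x i s))) =
    (\<Sum>s\<in>{-1, 1}. F (stay (partial_orthant d m) (fold_orthant d m x) (move (fold_orthant d m x) i s)))"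
proof -
  have "F (fold_orthant d m (move x i s)) =
      F (stay (partial_orthant d m) (fold_orthant d m x)
        (move (fold_orthant d m x) i (if i \<le> m \<and> x i < 0 then - s else s)))"
    if "s \<in> {-1, 1}" for s
    using that
    by (subst fold_orthant_move[OF x i that], subst fold_orthant_move_stay[OF fold_orthant_in[OF x] i])
       auto
  then show ?thesis by (cases "i \<le> m \<and> x i < 0") (auto simp: add.commute)
qed

text \<open>
  The image charges of the formula are the lattice points that fold onto \<open>y\<close>, each obtained from
  one sign vector: on a folded axis \<open>y i\<close> and \<open>- 1 - y i\<close> are never equal for an integer
  \<open>y i\<close>.
\<close>

lemma reflect_fibre:
  assumes y: "y \<in> partial_orthant d m"
  shows "bij_betw (\<lambda>v. reflect d v y) (\<Pi>\<^sub>E i\<in>{1..d}. if i \<le> m then {0, 1} else {0})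
    {z \<in> zlattice d. fold_orthant d m z = y}"
    (is "bij_betw ?R ?J ?B")
proof -
  have yz: "y \<in> zlattice d" and y0: "i \<in> {1..d} \<Longrightarrow> i \<le> m \<Longrightarrow> 0 \<le> y i" for i
    using y by (auto simp: partial_orthant_iff)
  have "inj_on ?R ?J"
  proof (rule inj_onI)
    fix v w assume v: "v \<in> ?J" and w: "w \<in> ?J" and eq: "?R v = ?R w"
    have "v i = w i" if "i \<in> {1..d}" for i
    proof (cases "i \<le> m")
      case True
      have "v i \<in> {0, 1}" "w i \<in> {0, 1}" using PiE_mem[OF v that] PiE_mem[OF w that] True by auto
      then show ?thesis
        using fun_cong[OF eq, of i] y0[OF that True] that by (auto simp: reflect_def)
    next
      case False
      then show ?thesis using PiE_mem[OF v that] PiE_mem[OF w that] by auto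
    qed
    then show "v = w" using v w by (intro PiE_ext)
  qed
  moreover have "?R ` ?J = ?B"
  proof (intro equalityI subsetI)
    fix z assume "z \<in> ?R ` ?J"
    then obtain v where v: "v \<in> ?J" and z: "z = ?R v" by auto
    have "fold_orthant d m z i = y i" for i
    proof (cases "i \<in> {1..d}")
      case True
      have "v i = 0 \<or> i \<le> m \<and> v i = 1" using PiE_mem[OF v True] by (auto split: if_splits)
      then show ?thesis using True y0[OF True] by (auto simp: z reflect_def fold_orthant_def)
    next
      case False
      then show ?thesis using yz by (auto simp: fold_orthant_def zlattice_def PiE_iff extensional_def)
    qed
    then show "z \<in> ?B" using reflect_in_zlattice[OF yz, of v] by (auto simp: z)
  next
    fix z assume "z \<in> ?B"
    then have z: "z \<in> zlattice d" and fold: "fold_orthant d m z = y" by auto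
    define v :: "nat \<Rightarrow> nat" where "v = (\<lambda>i\<in>{1..d}. if i \<le> m \<and> z i < 0 then 1 else 0)"
    have "v \<in> ?J" by (auto simp: v_def)
    moreover have "z = ?R v"
      using z by (auto simp: fun_eq_iff fold[symmetric] reflect_def v_def fold_orthant_def zlattice_def PiE_iff extensional_def)
    ultimately show "z \<in> ?R ` ?J" by blast
  qed
  ultimately show ?thesis by (simp add: bij_betw_def)
qed

text \<open>
  If the charge is symmetric, the reflected potential solves the same Poisson equation, so by
  minimality it is at least the potential itself; applying the reflection twice gives equality.
\<close>

lemma nn_potential_mirror:
  assumes d: "1 \<le> d" and i: "i \<in> {1..d}"
    and \<phi>: "\<And>x. x \<in> zlattice d \<Longrightarrow> \<phi> (mirror i x) = \<phi> x"
    and fin: "\<And>x. x \<in> zlattice d \<Longrightarrow> nn_potential d (zlattice d) \<phi> x < \<infinity>"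
    and x: "x \<in> zlattice d"
  shows "nn_potential d (zlattice d) \<phi> (mirror i x) = nn_potential d (zlattice d) \<phi> x"
proof -
  let ?P = "nn_potential d (zlattice d) \<phi>"
  have le: "?P x \<le> ?P (mirror i x)" if "x \<in> zlattice d" for x
  proof (rule nn_potential_zlattice_least[OF d _ _ that, where f = "\<lambda>x. ?P (mirror i x)"])
    fix x assume x: "x \<in> zlattice d"
    show "?P (mirror i x) < \<infinity>" using fin mirror_in_zlattice[OF x i] by simp
    have "(\<Sum>s\<in>{-1, 1}. ?P (move (mirror i x) j s)) = (\<Sum>s\<in>{-1, 1}. ?P (mirror i (move x j s)))" for j
      by (simp add: move_mirror add.commute)
    then show "\<phi> x + (\<Sum>j\<in>{1..d}. \<Sum>s\<in>{-1, 1}. ?P (mirror i (move x j s))) \<le> of_nat (2 * d) * ?P (mirror i x)"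
      unfolding nn_potential_zlattice_equation[OF d mirror_in_zlattice[OF x i]] by (simp add: \<phi>[OF x])
  qed
  show ?thesis
    using le[OF x] le[OF mirror_in_zlattice[OF x i]] by (simp add: mirror_mirror)
qed

text \<open>
  Each of the two inequalities is one use of the comparison principle. The lattice potential \<open>h\<close> of
  all image charges is symmetric, so the terms for steps out of the orthant equal \<open>h\<close> at the vertex
  itself, and \<open>h\<close> solves the lazy equation on the orthant. Conversely \<open>g\<close> composed with the
  folding map solves the equation that characterizes \<open>h\<close> on the lattice.
\<close>

lemma nn_green_partial_orthant:
  assumes d: "3 \<le> d" and x: "x \<in> partial_orthant d m" and y: "y \<in> partial_orthant d m"
  shows "nn_green d (partial_orthant d m) x y < \<infinity>" (is ?fin)
    and "nn_green d (partial_orthant d m) x y =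
      (\<Sum>v\<in>(\<Pi>\<^sub>E i\<in>{1..d}. if i \<le> m then {0, 1} else {0}). nn_green d (zlattice d) x (reflect d v y))"
      (is ?eq)
proof -
  let ?U = "partial_orthant d m" and ?Z = "zlattice d"
  let ?J = "\<Pi>\<^sub>E i\<in>{1..d}. if i \<le> m then {0, 1::nat} else {0}"
  define B where "B = {z \<in> ?Z. fold_orthant d m z = y}"
  define h where "h = nn_potential d ?Z (indicator B)"
  define g where "g = nn_potential d ?U (indicator {y})"
  have d1: "1 \<le> d" using d by simp
  have U: "x \<in> ?Z" if "x \<in> ?U" for x using that by (simp add: partial_orthant_iff)
  have finJ: "finite ?J" by (intro finite_PiE) auto
  \<comment> \<open>Superposition: the potential is additive in the charge.\<close>
  have h_eq: "h x = (\<Sum>v\<in>?J. nn_green d ?Z x (reflect d v y))" for x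
  proof -
    note bij = reflect_fibre[OF y, folded B_def]
    have finB: "finite B" using bij_betw_finite[OF bij] finJ by (simp only:)
    have "h x = nn_potential d ?Z (\<lambda>z. \<Sum>w\<in>B. indicator {w} z) x"
      unfolding h_def using finB by (simp add: indicator_def[abs_def] sum.delta' of_bool_def)
    also have "\<dots> = (\<Sum>w\<in>B. nn_green d ?Z x w)"
      by (simp add: potential_sum[OF finB] nn_green_eq_potential)
    also have "\<dots> = (\<Sum>v\<in>?J. nn_green d ?Z x (reflect d v y))"
      by (rule sum.reindex_bij_betw[OF bij, symmetric])
    finally show ?thesis .
  qed
  have h_fin: "h x < \<infinity>" if "x \<in> ?Z" for x
    unfolding h_eq
    using that finJ nn_potential_zlattice_finite[OF d that reflect_in_zlattice[OF U[OF y]]]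
    by (simp add: nn_green_eq_potential)
  have ind: "indicator B x = (indicator {y} (fold_orthant d m x) :: ennreal)" if "x \<in> ?Z" for x
    using that by (simp add: B_def indicator_def)
  have g_le_h: "g x \<le> h x" if "x \<in> ?U" for x
    unfolding g_def
  proof (rule nn_potential_least[OF d1 _ _ that])
    fix x assume x: "x \<in> ?U"
    show "h x < \<infinity>" using h_fin U[OF x] .
    have "h (stay ?U x (move x i s)) = h (move x i s)" if i: "i \<in> {1..d}" and s: "s \<in> {-1, 1}" for i s
    proof (cases "move x i s \<in> ?U")
      case False
      note out = move_outside_partial_orthant[OF x i s False]
      have "h (mirror i x) = h x"
        unfolding h_def
      proof (rule nn_potential_mirror[OF d1 i _ _ U[OF x]])
        show "indicator B (mirror i z) = (indicator B z :: ennreal)" if "z \<in> ?Z" for z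
          using that by (simp add: ind mirror_in_zlattice[OF _ i] fold_orthant_mirror[OF _ i out(1)])
      qed (use h_fin in \<open>simp add: h_def\<close>)
      then show ?thesis using False by (simp add: stay_def out(2))
    qed (simp add: stay_def)
    then have "(\<Sum>i\<in>{1..d}. \<Sum>s\<in>{-1, 1}. h (stay ?U x (move x i s))) =
        (\<Sum>i\<in>{1..d}. \<Sum>s\<in>{-1, 1}. h (move x i s))"
      by (intro sum.cong refl)
    then show "indicator {y} x + (\<Sum>i\<in>{1..d}. \<Sum>s\<in>{-1, 1}. h (stay ?U x (move x i s))) \<le> of_nat (2 * d) * h x"
      unfolding h_def nn_potential_zlattice_equation[OF d1 U[OF x]] ind[OF U[OF x]] fold_orthant_id[OF x]
      by simp
  qed
  have g_fin: "g x < \<infinity>" if "x \<in> ?U" for x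
    using g_le_h[OF that] h_fin[OF U[OF that]] by (rule order_le_less_trans)
  have h_le_g: "h x \<le> g (fold_orthant d m x)" if "x \<in> ?Z" for x
    unfolding h_def
  proof (rule nn_potential_zlattice_least[OF d1 _ _ that, where f = "\<lambda>x. g (fold_orthant d m x)"])
    fix x assume x: "x \<in> ?Z"
    show "g (fold_orthant d m x) < \<infinity>" by (rule g_fin[OF fold_orthant_in[OF x]])
    have "(\<Sum>i\<in>{1..d}. \<Sum>s\<in>{-1, 1}. g (fold_orthant d m (move x i s))) =
        (\<Sum>i\<in>{1..d}. \<Sum>s\<in>{-1, 1}. g (stay ?U (fold_orthant d m x) (move (fold_orthant d m x) i s)))"
      by (intro sum.cong refl sum_fold_orthant_move[OF x])
    then show "indicator B x + (\<Sum>i\<in>{1..d}. \<Sum>s\<in>{-1, 1}. g (fold_orthant d m (move x i s)))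
        \<le> of_nat (2 * d) * g (fold_orthant d m x)"
      unfolding g_def nn_potential_equation[OF d1 fold_orthant_in[OF x]] ind[OF x] by simp
  qed
  show ?fin using g_fin[OF x] by (simp add: g_def nn_green_eq_potential)
  have "g x = h x"
    using g_le_h[OF x] h_le_g[OF U[OF x]] by (simp add: fold_orthant_id[OF x])
  then show ?eq by (simp only: h_eq g_def nn_green_eq_potential)
qed

theorem proposition7:
  fixes d :: nat
  assumes "3 \<le> d"
  shows "(\<forall>m\<le>d. \<forall>x\<in>partial_orthant d m. \<forall>y\<in>partial_orthant d m.
            nn_green d (partial_orthant d m) x y < \<infinity> \<and>
            nn_green d (partial_orthant d m) x y =
              (\<Sum>v\<in>(\<Pi>\<^sub>E i\<in>{1..d}. if i \<le> m then {0, 1} else {0}).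
                 nn_green d (zlattice d) x (reflect d v y)))
       \<and> (\<forall>x\<in>orthant d. \<forall>y\<in>orthant d.
            nn_green d (orthant d) x y =
              (\<Sum>v\<in>{1..d} \<rightarrow>\<^sub>E {0, 1}. nn_green d (zlattice d) x (reflect d v y)))"
proof -
  have "(\<Pi>\<^sub>E i\<in>{1..d}. if i \<le> d then {0, 1} else {0}) = ({1..d} \<rightarrow>\<^sub>E {0, 1::nat})"
    by (intro PiE_cong) auto
  then show ?thesis
    using nn_green_partial_orthant[OF assms, of _ d] nn_green_partial_orthant[OF assms]
    by (simp add: partial_orthant_full)
qed

end
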